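(* Let $m\ge 2$ be even and $n\ge 1$, let $\mathcal{A}\in\mathbb{R}^{[n,m]}$ be a real symmetric tensor of order $m$ and dimension $n$, and put $d=n(m-1)^{n-1}$. Suppose that the $d$ eigenvalues of $\mathcal{A}$ (counted with multiplicity) are all real and positive, ordered as $\lambda_1\ge\lambda_2\ge\cdots\ge\lambda_d>0$. Let $k$ be an integer with $1\le k\le d$. Then $$\lambda_1+\cdots+\lambda_k\le\frac{(k+1)^{k+1}}{k^k}\,\frac{1}{\det(\mathcal{A})}\left(\frac{(m-1)^{n-1}\operatorname{tr}(\mathcal{A})}{d+1}\right)^{d+1}.$$
   Context: $\mathbb{R}^{[n,m]}$ is the set of real tensors $\mathcal{A}=(a_{i_1\cdots i_m})_{1\le i_1,\dots,i_m\le n}$ of order $m$ and dimension $n$. $\mathcal{A}$ is symmetric if its entries are invariant under every permutation of the indices. For a vector $x$, $\mathcal{A}x^{m-1}$ is the vector with $i$-th component $\sum_{i_2,\dots,i_m=1}^n a_{i i_2\cdots i_m}x_{i_2}\cdots x_{i_m}$. The identity tensor $\mathcal{I}$ has entry $1$ when $i_1=\cdots=i_m$ and $0$ otherwise. The trace $\operatorname{tr}(\mathcal{A})=\sum_{i=1}^n a_{ii\cdots i}$ is the sum of the diagonal entries. The resultant of $n$ homogeneous polynomials $f_1,\dots,f_n$ in $n$ variables of degrees $d_1,\dots,d_n$ is the unique polynomial in their coefficients such that (1) it vanishes if and only if $f_1=\cdots=f_n=0$ has a nonzero (complex) solution; (2) it equals $1$ when $f_i=x_i^{d_i}$ for all $i$;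 (3) it is irreducible when the coefficients are viewed as independent variables. The determinant $\det(\mathcal{A})$ is the resultant of the ordered system of $n$ homogeneous polynomials of degree $m-1$ given by the components of $\mathcal{A}x^{m-1}$. The eigenvalues of $\mathcal{A}$ are the complex roots of the characteristic polynomial $\phi(\lambda)=\det(\mathcal{A}-\lambda\mathcal{I})$, which has degree $d=n(m-1)^{n-1}$; counted with multiplicity there are $d$ of them. *)

theory Defs
  imports
    Complex_Main
    "HOL-Library.Poly_Mapping"
    "HOL-Library.Multiset"
    "HOL-Computational_Algebra.Polynomial"
    "HOL-Computational_Algebra.Factorial_Ring"
begin

text \<open>
  Indices of equations, variables and tensor modes are numbered from 0.
  A multivariate polynomial is a finitely supported map from exponent vectors to coefficients;
  the ring structure is the convolution product of \<^theory>\<open>HOL-Library.Poly_Mapping\<close>.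
\<close>

type_synonym ('v, 'a) mpoly = "('v \<Rightarrow>\<^sub>0 nat) \<Rightarrow>\<^sub>0 'a"

definition Var :: "'v \<Rightarrow> ('v, 'a::comm_ring_1) mpoly" where
  "Var v = Poly_Mapping.single (Poly_Mapping.single v 1) 1"

definition Const :: "'a::comm_ring_1 \<Rightarrow> ('v, 'a) mpoly" where
  "Const c = Poly_Mapping.single 0 c"

definition mpoly_eval :: "('v \<Rightarrow> 'a::comm_ring_1) \<Rightarrow> ('v, 'a) mpoly \<Rightarrow> 'a" where
  "mpoly_eval x p =
     (\<Sum>\<alpha>\<in>Poly_Mapping.keys p.
        Poly_Mapping.lookup p \<alpha> * (\<Prod>v\<in>Poly_Mapping.keys \<alpha>. x v ^ Poly_Mapping.lookup \<alpha> v))"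

abbreviation of_int_mpoly :: "('v, int) mpoly \<Rightarrow> ('v, 'a::comm_ring_1) mpoly" where
  "of_int_mpoly \<equiv> Poly_Mapping.map of_int"


subsection \<open>Resultants\<close>

text \<open>Exponent vectors of the monomials of degree \<open>k\<close> in the variables \<open>0, \<dots>, n - 1\<close>.\<close>

definition monomials :: "nat \<Rightarrow> nat \<Rightarrow> (nat \<Rightarrow>\<^sub>0 nat) set" where
  "monomials n k =
     {\<alpha>. Poly_Mapping.keys \<alpha> \<subseteq> {..<n} \<and> (\<Sum>j<n. Poly_Mapping.lookup \<alpha> j) = k}"

text \<open>As usual, the zero polynomial is homogeneous of every degree.\<close>

definition homogeneous :: "nat \<Rightarrow> nat \<Rightarrow> (nat, 'a::comm_ring_1) mpoly \<Rightarrow> bool" where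
  "homogeneous n k f \<longleftrightarrow> Poly_Mapping.keys f \<subseteq> monomials n k"

text \<open>
  The variable \<open>(i, \<alpha>)\<close> stands for the coefficient of the monomial \<open>x\<^sup>\<alpha>\<close> in the
  \<open>i\<close>-th polynomial of the system.
\<close>

type_synonym coeff_var = "nat \<times> (nat \<Rightarrow>\<^sub>0 nat)"

definition eval_at_system ::
  "(coeff_var, int) mpoly \<Rightarrow> (nat \<Rightarrow> (nat, 'a::comm_ring_1) mpoly) \<Rightarrow> 'a" where
  "eval_at_system R F = mpoly_eval (\<lambda>(i, \<alpha>). Poly_Mapping.lookup (F i) \<alpha>) (of_int_mpoly R)"

text \<open>
  The resultant has integer coefficients and is irreducible even over the complex numbers.
  Integrality allows it to be evaluated at systems over any commutative ring, in particular
  over a polynomial ring (for the characteristic polynomial) and over the reals.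
\<close>

definition is_resultant :: "nat \<Rightarrow> (nat \<Rightarrow> nat) \<Rightarrow> (coeff_var, int) mpoly \<Rightarrow> bool" where
  "is_resultant n d R \<longleftrightarrow>
     (\<forall>\<mu>\<in>Poly_Mapping.keys R. Poly_Mapping.keys \<mu> \<subseteq> {(i, \<alpha>). i < n \<and> \<alpha> \<in> monomials n (d i)}) \<and>
     (\<forall>F :: nat \<Rightarrow> (nat, complex) mpoly. (\<forall>i<n. homogeneous n (d i) (F i)) \<longrightarrow>
        (eval_at_system R F = 0 \<longleftrightarrow>
          (\<exists>x :: nat \<Rightarrow> complex. (\<exists>j<n. x j \<noteq> 0) \<and> (\<forall>i<n. mpoly_eval x (F i) = 0)))) \<and>
     eval_at_system R (\<lambda>i. Var i ^ d i) = (1 :: int) \<and>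
     irreducible (of_int_mpoly R :: (coeff_var, complex) mpoly)"

text \<open>
  For \<open>n \<ge> 1\<close> and positive degrees there is exactly one such polynomial, by the classical theory
  of resultants; where there is none (e.g. for \<open>n = 0\<close>) the value is 0.
\<close>

definition resultant_poly :: "nat \<Rightarrow> (nat \<Rightarrow> nat) \<Rightarrow> (coeff_var, int) mpoly" where
  "resultant_poly n d = (if \<exists>!R. is_resultant n d R then THE R. is_resultant n d R else 0)"

definition multi_resultant ::
  "nat \<Rightarrow> (nat \<Rightarrow> nat) \<Rightarrow> (nat \<Rightarrow> (nat, 'a::comm_ring_1) mpoly) \<Rightarrow> 'a" where
  "multi_resultant n d F = eval_at_system (resultant_poly n d) F"


subsection \<open>Tensors\<close>

text \<open>
  A tensor of order \<open>m\<close> and dimension \<open>n\<close> assigns an entry to each index list in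
  \<open>tensor_indices n m\<close>; values at other lists are never used.
\<close>

type_synonym 'a tensor = "nat list \<Rightarrow> 'a"

definition tensor_indices :: "nat \<Rightarrow> nat \<Rightarrow> nat list set" where
  "tensor_indices n m = {js. length js = m \<and> set js \<subseteq> {..<n}}"

definition symmetric_tensor :: "nat \<Rightarrow> nat \<Rightarrow> 'a tensor \<Rightarrow> bool" where
  "symmetric_tensor n m A \<longleftrightarrow>
     (\<forall>is\<in>tensor_indices n m. \<forall>js\<in>tensor_indices n m. mset is = mset js \<longrightarrow> A is = A js)"

definition identity_tensor :: "'a::comm_ring_1 tensor" where
  "identity_tensor js = (if \<forall>i\<in>set js. \<forall>j\<in>set js. i = j then 1 else 0)"

definition tensor_trace :: "nat \<Rightarrow> nat \<Rightarrow> 'a::comm_ring_1 tensor \<Rightarrow> 'a" where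
  "tensor_trace n m A = (\<Sum>i<n. A (replicate m i))"

text \<open>The \<open>i\<close>-th component of \<open>A x\<^bsup>m-1\<^esup>\<close> as a polynomial in \<open>x\<close>.\<close>

definition tensor_component ::
  "nat \<Rightarrow> nat \<Rightarrow> 'a::comm_ring_1 tensor \<Rightarrow> nat \<Rightarrow> (nat, 'a) mpoly" where
  "tensor_component n m A i =
     (\<Sum>js\<in>tensor_indices n (m - 1). Const (A (i # js)) * (\<Prod>j\<leftarrow>js. Var j))"

definition tensor_det :: "nat \<Rightarrow> nat \<Rightarrow> 'a::comm_ring_1 tensor \<Rightarrow> 'a" where
  "tensor_det n m A = multi_resultant n (\<lambda>_. m - 1) (tensor_component n m A)"

text \<open>\<open>det (A - \<lambda> I)\<close>, with \<open>[:0, 1:]\<close> as the indeterminate \<open>\<lambda>\<close>.\<close>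

definition tensor_char_poly :: "nat \<Rightarrow> nat \<Rightarrow> 'a::comm_ring_1 tensor \<Rightarrow> 'a poly" where
  "tensor_char_poly n m A = tensor_det n m (\<lambda>js. [:A js:] - [:0, 1:] * identity_tensor js)"

text \<open>The multiset of complex eigenvalues, with algebraic multiplicities.\<close>

definition tensor_eigenvalues :: "nat \<Rightarrow> nat \<Rightarrow> real tensor \<Rightarrow> complex multiset" where
  "tensor_eigenvalues n m A = proots (tensor_char_poly n m (\<lambda>js. complex_of_real (A js)))"

end

theory Submission
  imports
    Defs
    "HOL-Computational_Algebra.Fundamental_Theorem_Algebra"
    "HOL-Analysis.Convex"
begin

text \<open>
  Let \<open>E\<close> denote evaluation of the resultant at a system of \<open>n\<close> forms of degree \<open>D = m - 1\<close>. The
  eigenvalue hypothesis provides the resultant and fixes \<open>deg \<phi> = d\<close>; everything else is read off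
  from the zero set of the resultant, since a univariate complex polynomial without zeros is constant.
  So \<open>E\<close> does not change when a multiple of one form is added to another one, which makes the \<open>n\<close>
  equations play symmetric roles, and when a monomial other than \<open>x\<^sub>j\<^sup>D\<close> is added to the \<open>j\<close>-th form of
  the system \<open>e = (x\<^sub>1\<^sup>D, \<dots>, x\<^sub>n\<^sup>D)\<close>. Moreover \<open>E\<close> is homogeneous on the pencil spanned by \<open>e\<close> and
  the forms of the tensor. Hence the leading coefficient of \<open>\<phi>\<close> is \<open>(-1)\<^sup>d\<close> and the eigenvalues sum to
  \<open>(d / n) tr A\<close> and multiply to \<open>det A\<close>. The bound is then the AM-GM inequality for \<open>d + 1\<close> numbers.
\<close>

subsection \<open>Evaluation of integer polynomials\<close>

text \<open>The sum runs over the keys of \<open>R\<close> itself and not over those of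
  \<open>of_int_mpoly R\<close>, which may be fewer when integers vanish in the target ring; one
  index set thus serves all rings.\<close>

definition int_mpoly_eval :: "('v, int) mpoly \<Rightarrow> ('v \<Rightarrow> 'a::comm_ring_1) \<Rightarrow> 'a" where
  "int_mpoly_eval R u =
     (\<Sum>\<mu>\<in>Poly_Mapping.keys R. of_int (Poly_Mapping.lookup R \<mu>) *
        (\<Prod>v\<in>Poly_Mapping.keys \<mu>. u v ^ Poly_Mapping.lookup \<mu> v))"

lemma lookup_of_int_mpoly:
  "Poly_Mapping.lookup (of_int_mpoly R :: ('v, 'a::comm_ring_1) mpoly) \<mu> =
     of_int (Poly_Mapping.lookup R \<mu>)"
  by (cases "Poly_Mapping.lookup R \<mu> = 0") (auto simp: Poly_Mapping.map.rep_eq when_def)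

lemma mpoly_eval_of_int_mpoly: "mpoly_eval u (of_int_mpoly R) = int_mpoly_eval R u"
  unfolding mpoly_eval_def int_mpoly_eval_def lookup_of_int_mpoly
  by (rule sum.mono_neutral_left) (auto simp: in_keys_iff lookup_of_int_mpoly)

lemma eval_at_system_conv:
  "eval_at_system R F = int_mpoly_eval R (\<lambda>(i, \<alpha>). Poly_Mapping.lookup (F i) \<alpha>)"
  by (simp add: eval_at_system_def mpoly_eval_of_int_mpoly)

lemma int_mpoly_eval_cong:
  assumes "\<And>v. v \<in> \<Union>(Poly_Mapping.keys ` Poly_Mapping.keys R) \<Longrightarrow> u v = u' v"
  shows "int_mpoly_eval R u = int_mpoly_eval R u'"
  unfolding int_mpoly_eval_def using assms
  by (intro sum.cong refl arg_cong2[where f = "(*)"] prod.cong arg_cong2[where f = "(^)"]) auto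

text \<open>Ring homomorphisms preserve integer coefficients. The instances used below are
  evaluation of polynomials at a point, \<open>of_int\<close> and
  \<open>complex_of_real\<close>.\<close>

lemma int_mpoly_eval_hom:
  fixes R :: "('v, int) mpoly" and h :: "'a::comm_ring_1 \<Rightarrow> 'b::comm_ring_1"
  assumes one: "h 1 = 1" and add: "\<And>x y. h (x + y) = h x + h y"
    and mult: "\<And>x y. h (x * y) = h x * h y"
  shows "h (int_mpoly_eval R u) = int_mpoly_eval R (\<lambda>v. h (u v))"
proof -
  have zero: "h 0 = 0"
    using add[of 0 0] by simp
  have minus: "h (- x) = - h x" for x
    using add[of x "- x"] zero by (simp add: eq_neg_iff_add_eq_0 add.commute)
  have nat: "h (of_nat k) = of_nat k" for k
    by (induction k) (simp_all add: zero one add)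
  have int: "h (of_int z) = of_int z" for z
    by (cases z rule: int_cases2) (simp_all add: nat minus)
  have power: "h (x ^ k) = h x ^ k" for x k
    by (induction k) (simp_all add: one mult)
  have sum: "h (\<Sum>i\<in>I. f i) = (\<Sum>i\<in>I. h (f i))" for f :: "('v \<Rightarrow>\<^sub>0 nat) \<Rightarrow> 'a" and I
    by (induction I rule: infinite_finite_induct) (simp_all add: zero add)
  have prod: "h (\<Prod>i\<in>I. f i) = (\<Prod>i\<in>I. h (f i))" for f :: "'v \<Rightarrow> 'a" and I
    by (induction I rule: infinite_finite_induct) (simp_all add: one mult)
  show ?thesis
    unfolding int_mpoly_eval_def sum mult int prod power ..
qed

lemma poly_int_mpoly_eval:
  fixes u :: "'v \<Rightarrow> 'a::comm_ring_1 poly"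
  shows "poly (int_mpoly_eval R u) c = int_mpoly_eval R (\<lambda>v. poly (u v) c)"
  by (rule int_mpoly_eval_hom) auto

section \<open>Formal partial derivatives\<close>

definition int_mpoly_grad :: "('v, int) mpoly \<Rightarrow> ('v \<Rightarrow> 'a::comm_ring_1) \<Rightarrow> 'v \<Rightarrow> 'a" where
  "int_mpoly_grad R u v = (\<Sum>\<mu>\<in>Poly_Mapping.keys R. if v \<in> Poly_Mapping.keys \<mu> then
     of_int (Poly_Mapping.lookup R \<mu>) *
     ((\<Prod>w\<in>Poly_Mapping.keys \<mu> - {v}. u w ^ Poly_Mapping.lookup \<mu> w) *
      (of_nat (Poly_Mapping.lookup \<mu> v) * u v ^ (Poly_Mapping.lookup \<mu> v - 1))) else 0)"

lemma pderiv_sum: "pderiv (\<Sum>i\<in>I. f i) = (\<Sum>i\<in>I. pderiv (f i))"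
  by (induction I rule: infinite_finite_induct) (simp_all add: pderiv_add)

text \<open>Chain rule: the coefficient of s in R(u + s a) is the derivative at \<open>u\<close> in
  the direction \<open>a\<close>.\<close>

lemma coeff_1_int_mpoly_eval:
  fixes u a :: "'v \<Rightarrow> 'a::idom"
  assumes "finite V" and V: "\<Union>(Poly_Mapping.keys ` Poly_Mapping.keys R) \<subseteq> V"
  shows "coeff (int_mpoly_eval R (\<lambda>v. [:u v, a v:])) 1 = (\<Sum>v\<in>V. a v * int_mpoly_grad R u v)"
proof -
  have "coeff (int_mpoly_eval R (\<lambda>v. [:u v, a v:])) 1 =
        poly (pderiv (int_mpoly_eval R (\<lambda>v. [:u v, a v:]))) 0"
    by (simp add: poly_0_coeff_0 coeff_pderiv)
  also have "\<dots> = (\<Sum>\<mu>\<in>Poly_Mapping.keys R. of_int (Poly_Mapping.lookup R \<mu>) *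
     (\<Sum>v\<in>Poly_Mapping.keys \<mu>. (\<Prod>w\<in>Poly_Mapping.keys \<mu> - {v}. u w ^ Poly_Mapping.lookup \<mu> w) *
      (of_nat (Poly_Mapping.lookup \<mu> v) * u v ^ (Poly_Mapping.lookup \<mu> v - 1) * a v)))"
    by (simp add: int_mpoly_eval_def pderiv_sum pderiv_mult pderiv_prod pderiv_power pderiv_pCons
        poly_sum poly_prod poly_power of_int_poly pderiv_smult mult_ac)
  also have "\<dots> = (\<Sum>\<mu>\<in>Poly_Mapping.keys R. \<Sum>v\<in>V. a v * (if v \<in> Poly_Mapping.keys \<mu> then
     of_int (Poly_Mapping.lookup R \<mu>) *
     ((\<Prod>w\<in>Poly_Mapping.keys \<mu> - {v}. u w ^ Poly_Mapping.lookup \<mu> w) *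
      (of_nat (Poly_Mapping.lookup \<mu> v) * u v ^ (Poly_Mapping.lookup \<mu> v - 1))) else 0))"
    using V \<open>finite V\<close>
    by (intro sum.cong refl, subst sum_distrib_left)
       (rule sum.mono_neutral_cong_left, auto)
  also have "\<dots> = (\<Sum>v\<in>V. a v * int_mpoly_grad R u v)"
    unfolding int_mpoly_grad_def sum_distrib_left by (rule sum.swap)
  finally show ?thesis .
qed

subsection \<open>Univariate polynomials without zeros\<close>

lemma complex_poly_nonvanishing_const:
  fixes p :: "complex poly"
  assumes "\<And>z. poly p z \<noteq> 0"
  shows "degree p = 0"
  using fundamental_theorem_of_algebra[of p] assms constant_degree[of p] by blast

text \<open>Dividing out the exact power of the variable leaves a factor without any zero, hence a
  constant.\<close>

lemma complex_poly_nonvanishing_monom: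
  fixes p :: "complex poly"
  assumes "\<And>z. z \<noteq> 0 \<Longrightarrow> poly p z \<noteq> 0"
  obtains c k where "p = monom c k"
proof -
  have "p \<noteq> 0"
    using assms[of 1] by auto
  then obtain q where q: "p = [:-0, 1:] ^ order 0 p * q" "\<not> [:-0, 1:] dvd q"
    using order_decomp[of p 0] by blast
  have "poly q z \<noteq> 0" for z
  proof (cases "z = 0")
    case True
    then show ?thesis using q(2) by (simp add: dvd_iff_poly_eq_0)
  next
    case False
    then show ?thesis using assms[of z] by (subst (asm) q(1)) auto
  qed
  then have "degree q = 0"
    by (rule complex_poly_nonvanishing_const)
  then obtain c where "q = [:c:]"
    by (rule degree_eq_zeroE)
  then have "p = monom c (order 0 p)"
    using q(1) by (simp add: monom_altdef)
  then show thesis ..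
qed

text \<open>Specialising the inner variable to \<open>s\<close> first makes the univariate lemmas
  applicable to the outer one.\<close>

lemma poly_map_poly_poly:
  "poly (map_poly (\<lambda>q. poly q s) p) c = poly (poly p [:c:]) (s :: 'a::comm_ring_1)"
  by (induction p) (auto simp: map_poly_pCons algebra_simps)

text \<open>
  For each \<open>s\<close> where \<open>p\<close> does not vanish it is a monomial in the outer variable; two different
  exponents cannot both occur, since polynomials in \<open>s\<close> have no zero divisors.
\<close>

lemma complex_poly_poly_monomial:
  fixes p :: "complex poly poly"
  assumes nz: "\<And>s c. c \<noteq> 0 \<Longrightarrow> poly (poly p 1) s \<noteq> 0 \<Longrightarrow> poly (poly p [:c:]) s \<noteq> 0"
    and "poly p 1 \<noteq> 0"
  obtains N where "p = monom (poly p 1) N"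
proof -
  have ex: "\<exists>k. \<forall>j. j \<noteq> k \<longrightarrow> poly (coeff p j) s = 0" if s: "poly (poly p 1) s \<noteq> 0" for s
  proof -
    have "poly (map_poly (\<lambda>q. poly q s) p) c \<noteq> 0" if "c \<noteq> 0" for c
      using nz[OF that s] by (simp add: poly_map_poly_poly)
    then obtain b k where "map_poly (\<lambda>q. poly q s) p = monom b k"
      by (rule complex_poly_nonvanishing_monom)
    then have "poly (coeff p j) s = (if j = k then b else 0)" for j
      by (metis coeff_map_poly coeff_monom poly_0)
    then show ?thesis by metis
  qed
  have "coeff p i * coeff p j = 0" if "i \<noteq> j" for i j
  proof -
    \<comment> \<open>The factor \<open>poly p 1\<close> covers the exceptional points
      \<open>s\<close>, about which \<open>ex\<close> says nothing; it is cancelled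
      afterwards.\<close>
    have "poly (coeff p i * coeff p j * poly p 1) s = 0" for s
    proof (cases "poly (poly p 1) s = 0")
      case False
      from ex[OF this] obtain k where "\<forall>j. j \<noteq> k \<longrightarrow> poly (coeff p j) s = 0" ..
      with that have "poly (coeff p i) s = 0 \<or> poly (coeff p j) s = 0"
        by (cases "i = k") auto
      then show ?thesis by auto
    qed simp
    then have "coeff p i * coeff p j * poly p 1 = 0"
      using poly_all_0_iff_0 by blast
    then show ?thesis
      using assms(2) by simp
  qed
  moreover from assms(2) obtain N where "coeff p N \<noteq> 0"
    by (metis leading_coeff_neq_0 poly_0)
  ultimately have "coeff p j = 0" if "j \<noteq> N" for j
    using that by (metis mult_eq_0_iff)
  then have p: "p = monom (coeff p N) N"
    by (auto simp: poly_eq_iff coeff_monom)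
  then have "poly p 1 = coeff p N"
    by (metis poly_monom power_one mult.right_neutral)
  with p show thesis
    by (metis that)
qed

text \<open>Passing from q to z^N q(1/z) reverses the coefficients. After multiplication by z^M,
  with \<open>M\<close> the degree of \<open>q\<close>, both sides are polynomials that agree off 0,
  hence are equal. The case \<open>M > N\<close> is not excluded beforehand.\<close>

lemma coeff_homogenize:
  fixes p q :: "'a::{field_char_0} poly"
  assumes "\<And>z. z \<noteq> 0 \<Longrightarrow> poly p z = z ^ N * poly q (1 / z)"
  shows "i \<le> N \<Longrightarrow> coeff p (N - i) = coeff q i" and "j > N \<Longrightarrow> coeff p j = 0"
proof -
  define M where "M = degree q"
  have "poly (monom 1 M * p) z = poly (monom 1 N * reflect_poly q) z" if "z \<in> - {0}" for z
    using that assms[of z] by (simp add: poly_monom poly_reflect_poly_nz M_def inverse_eq_divide)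
  then have "- {0} \<subseteq> {z. poly (monom 1 M * p - monom 1 N * reflect_poly q) z = 0}"
    by auto
  moreover have "infinite (- {0 :: 'a})"
    by (simp add: infinite_UNIV_char_0)
  ultimately have eq: "monom 1 M * p = monom 1 N * reflect_poly q"
    by (metis eq_iff_diff_eq_0 finite_subset poly_roots_finite)
  then have coeff: "(if l < M then 0 else coeff p (l - M)) =
      (if l < N then 0 else coeff (reflect_poly q) (l - N))" for l
    by (metis coeff_monom_mult mult_1 not_le)
  show "coeff p j = 0" if "j > N"
    using coeff[of "M + j"] that by (simp add: coeff_reflect_poly M_def)
  \<comment> \<open>The index \<open>M + N - i\<close> becomes \<open>N - i\<close> on the left and,
    for \<open>i \<le> M\<close>, the reflected position \<open>M - i\<close> on the right.\<close>
  show "coeff p (N - i) = coeff q i" if "i \<le> N"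
  proof (cases "i \<le> M")
    case True
    then show ?thesis
      using coeff[of "M + N - i"] that by (auto simp: coeff_reflect_poly M_def split: if_splits)
  next
    case False
    then show ?thesis
      using coeff[of "M + N - i"] that by (auto simp: coeff_eq_0 M_def split: if_splits)
  qed
qed

subsection \<open>Systems of homogeneous polynomials given by their coefficients\<close>

lemma finite_monomials: "finite (monomials n k)"
proof (rule finite_imageD)
  let ?f = "\<lambda>\<alpha> :: nat \<Rightarrow>\<^sub>0 nat. restrict (Poly_Mapping.lookup \<alpha>) {..<n}"
  have "Poly_Mapping.lookup \<alpha> j \<le> k" if "\<alpha> \<in> monomials n k" "j < n" for \<alpha> j
    using that member_le_sum[of j "{..<n}" "Poly_Mapping.lookup \<alpha>"] by (auto simp: monomials_def)
  then have "?f ` monomials n k \<subseteq> {..<n} \<rightarrow>\<^sub>E {..k}"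
    by (auto split: if_splits)
  then show "finite (?f ` monomials n k)"
    by (rule finite_subset) (simp add: finite_PiE)
  show "inj_on ?f (monomials n k)"
  proof (rule inj_onI, rule poly_mapping_eqI)
    fix \<alpha> \<beta> j
    assume "\<alpha> \<in> monomials n k" "\<beta> \<in> monomials n k" and eq: "?f \<alpha> = ?f \<beta>"
    then have "Poly_Mapping.lookup \<alpha> j = 0" "Poly_Mapping.lookup \<beta> j = 0" if "\<not> j < n"
      using that by (auto simp: monomials_def in_keys_iff subset_iff)
    then show "Poly_Mapping.lookup \<alpha> j = Poly_Mapping.lookup \<beta> j"
      using fun_cong[OF eq, of j] by (cases "j < n") auto
  qed
qed

lemma single_in_monomials: "i < n \<Longrightarrow> Poly_Mapping.single i k \<in> monomials n k"
  by (auto simp: monomials_def lookup_single when_def)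

text \<open>Serves to find a second variable in every monomial other than the pure power of the
  \<open>j\<close>-th one.\<close>

lemma in_monomials_single_iff:
  assumes "\<alpha> \<in> monomials n k" "j < n"
  shows "\<alpha> = Poly_Mapping.single j k \<longleftrightarrow> (\<forall>l<n. l \<noteq> j \<longrightarrow> Poly_Mapping.lookup \<alpha> l = 0)"
proof
  assume *: "\<forall>l<n. l \<noteq> j \<longrightarrow> Poly_Mapping.lookup \<alpha> l = 0"
  then have "(\<Sum>l<n. Poly_Mapping.lookup \<alpha> l) = Poly_Mapping.lookup \<alpha> j"
    using assms(2) by (subst sum.remove[of _ j]) auto
  then have "Poly_Mapping.lookup \<alpha> j = k"
    using assms(1) by (simp add: monomials_def)
  moreover have "Poly_Mapping.lookup \<alpha> l = 0" if "l \<noteq> j" for l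
    using * that assms(1) by (cases "l < n") (auto simp: monomials_def in_keys_iff subset_iff)
  ultimately show "\<alpha> = Poly_Mapping.single j k"
    by (intro poly_mapping_eqI) (auto simp: lookup_single when_def)
qed (simp add: lookup_single when_def)

text \<open>A system is represented by its coefficient function, so that pencils and row operations
  are pointwise expressions.\<close>

definition form_eval :: "nat \<Rightarrow> nat \<Rightarrow> (coeff_var \<Rightarrow> 'a::comm_ring_1) \<Rightarrow> nat \<Rightarrow> (nat \<Rightarrow> 'a) \<Rightarrow> 'a" where
  "form_eval n D u i x =
     (\<Sum>\<alpha>\<in>monomials n D. u (i, \<alpha>) * (\<Prod>j<n. x j ^ Poly_Mapping.lookup \<alpha> j))"

text \<open>The system of pure powers, at which the resultant is normalised to 1; it is also the
  system of the identity tensor.\<close>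

definition power_system :: "nat \<Rightarrow> coeff_var \<Rightarrow> 'a::comm_ring_1" where
  "power_system D = (\<lambda>(i, \<alpha>). if \<alpha> = Poly_Mapping.single i D then 1 else 0)"

lemma prod_single_lookup:
  fixes x :: "nat \<Rightarrow> 'a::comm_ring_1"
  assumes "i < n"
  shows "(\<Prod>j<n. x j ^ Poly_Mapping.lookup (Poly_Mapping.single i D) j) = x i ^ D"
proof -
  have "(\<Prod>j<n. x j ^ Poly_Mapping.lookup (Poly_Mapping.single i D) j) =
      (\<Prod>j<n. if j = i then x i ^ D else 1)"
    by (rule prod.cong) (auto simp: lookup_single when_def)
  with \<open>i < n\<close> show ?thesis by simp
qed

lemma form_eval_power_system: "i < n \<Longrightarrow> form_eval n D (power_system D) i x = x i ^ D"
  unfolding form_eval_def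
  by (subst sum.remove[OF finite_monomials single_in_monomials[of i n D]])
     (auto simp: power_system_def prod_single_lookup intro!: sum.neutral)

text \<open>Systems and equation numbers vary independently, which covers row operations inside one
  system as well as pencils of two systems.\<close>

lemma form_eval_lincomb:
  assumes "\<And>\<alpha>. u (i, \<alpha>) = v (j, \<alpha>) + c * w (k, \<alpha>)"
  shows "form_eval n D u i x = form_eval n D v j x + c * form_eval n D w k x"
  unfolding form_eval_def assms sum_distrib_left
  by (subst sum.distrib [symmetric]) (simp add: algebra_simps)

lemma form_eval_cong:
  assumes "\<And>\<alpha>. u (i, \<alpha>) = v (j, \<alpha>)"
  shows "form_eval n D u i x = form_eval n D v j x"
  unfolding form_eval_def assms ..

lemma form_eval_unit:
  assumes "\<alpha> \<in> monomials n D"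
  shows "form_eval n D (\<lambda>v. if v = (i, \<alpha>) then 1 else 0) l x =
     (if l = i then \<Prod>j<n. x j ^ Poly_Mapping.lookup \<alpha> j else 0)"
  unfolding form_eval_def
  by (subst sum.remove[OF finite_monomials assms]) (auto intro!: sum.neutral)

lemma lookup_Var_power:
  "Poly_Mapping.lookup (Var i ^ k :: (nat, int) mpoly) \<alpha> =
     (if \<alpha> = Poly_Mapping.single i k then 1 else 0)"
proof -
  have "(Var i ^ k :: (nat, int) mpoly) = Poly_Mapping.single (Poly_Mapping.single i k) 1"
    by (induction k) (simp_all add: Var_def mult_single flip: single_add)
  then show ?thesis
    by (simp add: lookup_single when_def)
qed

section \<open>Normalisation and zero set of the resultant\<close>

locale resultant_polynomial =
  fixes n D :: nat and R :: "(coeff_var, int) mpoly"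
  assumes n_pos: "n \<ge> 1" and D_pos: "D \<ge> 1" and is_resultant: "is_resultant n (\<lambda>_. D) R"
begin

abbreviation E :: "(coeff_var \<Rightarrow> 'a::comm_ring_1) \<Rightarrow> 'a" where
  "E \<equiv> int_mpoly_eval R"

abbreviation V :: "coeff_var set" where
  "V \<equiv> {..<n} \<times> monomials n D"

lemma finite_V: "finite V"
  by (simp add: finite_monomials)

lemma keys_subset_V: "\<Union>(Poly_Mapping.keys ` Poly_Mapping.keys R) \<subseteq> V"
  using is_resultant by (auto simp: is_resultant_def)

lemma E_cong:
  assumes "\<And>i \<alpha>. i < n \<Longrightarrow> \<alpha> \<in> monomials n D \<Longrightarrow> u (i, \<alpha>) = v (i, \<alpha>)"
  shows "E u = E v"
  using keys_subset_V assms by (intro int_mpoly_eval_cong) blast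

lemma E_power_system [simp]: "E (power_system D :: _ \<Rightarrow> 'a::comm_ring_1) = 1"
proof -
  have "E (power_system D :: _ \<Rightarrow> int) = 1"
    using is_resultant
    by (simp add: is_resultant_def eval_at_system_conv lookup_Var_power power_system_def)
  then have "of_int (E (power_system D :: _ \<Rightarrow> int)) = (1 :: 'a)"
    by simp
  also have "of_int (E (power_system D :: _ \<Rightarrow> int)) = E (\<lambda>v. of_int (power_system D v) :: 'a)"
    by (rule int_mpoly_eval_hom) auto
  also have "\<dots> = E (power_system D)"
    by (intro E_cong) (simp add: power_system_def)
  finally show ?thesis .
qed

text \<open>The polynomials \<open>F\<close> keep only the monomials of degree \<open>D\<close>, so
  they are homogeneous for every \<open>u\<close>, and \<open>E\<close> reads no other
  coefficients.\<close>

lemma E_eq_0_iff: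
  fixes u :: "coeff_var \<Rightarrow> complex"
  shows "E u = 0 \<longleftrightarrow> (\<exists>x. (\<exists>j<n. x j \<noteq> 0) \<and> (\<forall>i<n. form_eval n D u i x = 0))"
proof -
  define F where "F i = (\<Sum>\<alpha>\<in>monomials n D. Poly_Mapping.single \<alpha> (u (i, \<alpha>)))" for i
  have lookup_F: "Poly_Mapping.lookup (F i) \<alpha> = (if \<alpha> \<in> monomials n D then u (i, \<alpha>) else 0)" for i \<alpha>
    by (simp add: F_def lookup_sum lookup_single when_def finite_monomials)
  then have "homogeneous n D (F i)" for i
    by (auto simp: homogeneous_def in_keys_iff split: if_splits)
  moreover have "mpoly_eval x (F i) = form_eval n D u i x" for i x
  proof -
    have "mpoly_eval x (F i) = (\<Sum>\<alpha>\<in>monomials n D. Poly_Mapping.lookup (F i) \<alpha> *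
        (\<Prod>j\<in>Poly_Mapping.keys \<alpha>. x j ^ Poly_Mapping.lookup \<alpha> j))"
      unfolding mpoly_eval_def using lookup_F
      by (intro sum.mono_neutral_left) (auto simp: finite_monomials in_keys_iff split: if_splits)
    also have "\<dots> = form_eval n D u i x"
      unfolding form_eval_def
      by (intro sum.cong refl arg_cong2[where f = "(*)"] prod.mono_neutral_left)
         (auto simp: lookup_F monomials_def in_keys_iff)
    finally show ?thesis .
  qed
  moreover have "eval_at_system R F = E u"
    unfolding eval_at_system_conv by (rule E_cong) (simp add: lookup_F)
  moreover have "eval_at_system R F = 0 \<longleftrightarrow>
      (\<exists>x. (\<exists>j<n. x j \<noteq> 0) \<and> (\<forall>i<n. mpoly_eval x (F i) = 0))"
    if "\<forall>i<n. homogeneous n D (F i)"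
    using is_resultant that unfolding is_resultant_def by blast
  ultimately show ?thesis by simp
qed

section \<open>Row operations\<close>

text \<open>The operation keeps the common zeros. As \<open>E u\<close> is nonzero, \<open>E\<close>
  is a polynomial in \<open>c\<close> without zeros, hence constant.\<close>

lemma E_shear:
  fixes u :: "coeff_var \<Rightarrow> complex"
  assumes "i < n" "j < n" "i \<noteq> j" and "E u \<noteq> 0"
  shows "E (\<lambda>(l, \<alpha>). if l = i then u (i, \<alpha>) + c * u (j, \<alpha>) else u (l, \<alpha>)) = E u"
    (is "E (?S c) = _")
proof -
  define p where "p = E (\<lambda>(l, \<alpha>). if l = i then [:u (i, \<alpha>), u (j, \<alpha>):] else [:u (l, \<alpha>):])"
  have p: "poly p c = E (?S c)" for c
    unfolding p_def poly_int_mpoly_eval by (rule E_cong) simp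
  have "poly p c \<noteq> 0" for c
  proof
    assume "poly p c = 0"
    then obtain x where x: "\<exists>j<n. x j \<noteq> 0" "\<forall>l<n. form_eval n D (?S c) l x = 0"
      unfolding p E_eq_0_iff by blast
    have "form_eval n D (?S c) l x = form_eval n D u l x" if "l \<noteq> i" for l
      using that by (intro form_eval_cong) simp
    moreover have "form_eval n D (?S c) i x = form_eval n D u i x + c * form_eval n D u j x"
      by (rule form_eval_lincomb) simp
    ultimately have "form_eval n D u l x = 0" if "l < n" for l
      using x(2) assms that by (cases "l = i") auto
    with x(1) have "E u = 0"
      unfolding E_eq_0_iff by blast
    with assms show False by simp
  qed
  then have "degree p = 0"
    by (rule complex_poly_nonvanishing_const)
  then obtain b where "p = [:b:]"
    by (rule degree_eq_zeroE)
  then have "poly p c = poly p 0"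
    by simp
  also have "poly p 0 = E u"
    unfolding p by (rule E_cong) auto
  finally show ?thesis
    by (simp add: p)
qed

definition scaled_power :: "nat \<Rightarrow> complex \<Rightarrow> coeff_var \<Rightarrow> complex" where
  "scaled_power i t v = (if v = (i, Poly_Mapping.single i D) then t else power_system D v)"

text \<open>Four shears move the factor \<open>t\<close> from one equation to another: they have product \<open>diag(t, 1 / t)\<close>.\<close>

lemma E_scaled_power_eq:
  assumes ij: "i < n" "j < n" and t: "t \<noteq> 0"
  shows "E (scaled_power i t) = E (scaled_power j t)"
proof (cases "i = j")
  case False
  define S where "S i j c u = (\<lambda>(l, \<alpha>). if l = i then u (i, \<alpha>) + c * u (j, \<alpha>) else u (l, \<alpha>))"
    for i j :: nat and c :: complex and u :: "coeff_var \<Rightarrow> complex"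
  let ?u = "scaled_power j t"
  \<comment> \<open>Shears are available only where \<open>E\<close> does not vanish.\<close>
  have "E ?u \<noteq> 0"
  proof
    assume "E ?u = 0"
    then obtain x where x: "\<exists>l<n. x l \<noteq> 0" "\<forall>l<n. form_eval n D ?u l x = 0"
      unfolding E_eq_0_iff by blast
    have "form_eval n D ?u l x = form_eval n D (power_system D) l x" if "l \<noteq> j" for l
      using that by (intro form_eval_cong) (simp add: scaled_power_def)
    moreover have "form_eval n D ?u j x = form_eval n D (power_system D) j x
        + (t - 1) * form_eval n D (power_system D) j x"
      by (rule form_eval_lincomb) (simp add: scaled_power_def power_system_def)
    ultimately have "x l = 0" if "l < n" for l
      using x(2) that t by (cases "l = j") (auto simp: form_eval_power_system algebra_simps)
    with x(1) show False by blast
  qed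
  moreover have "E (S i j c u) = E u" "E (S j i c u) = E u" if "E u \<noteq> 0" for c u
    unfolding S_def using E_shear[of i j u c] E_shear[of j i u c] ij False that by auto
  \<comment> \<open>With e, f for the pure powers in equations i, j, the two rows pass through (e, t
    f), (e, e + t f), (t e + t (t - 1) f, e + t f), (t e + t (t - 1) f, f) and (t e, f).\<close>
  ultimately have "E (S i j (- (t * (t - 1))) (S j i (- 1 / t) (S i j (t - 1) (S j i 1 ?u)))) = E ?u"
    by metis
  also have "S i j (- (t * (t - 1))) (S j i (- 1 / t) (S i j (t - 1) (S j i 1 ?u))) = scaled_power i t"
    using False t
    by (auto simp: S_def scaled_power_def power_system_def fun_eq_iff field_simps)
  finally show ?thesis .
qed simp

section \<open>First derivatives of the resultant at the power system\<close>

text \<open>The perturbed system has only the trivial zero for every s: the equations other than the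
  \<open>j\<close>-th kill all other variables, one of them occurs in the added monomial, and the
  \<open>j\<close>-th equation then gives x_j = 0.\<close>

lemma E_perturb_const:
  assumes "j < n" "\<alpha> \<in> monomials n D" "\<alpha> \<noteq> Poly_Mapping.single j D"
  shows "degree (E (\<lambda>v. [:power_system D v, if v = (j, \<alpha>) then 1 else 0 :: complex:])) = 0"
    (is "degree ?p = 0")
proof (rule complex_poly_nonvanishing_const)
  fix s
  let ?d = "\<lambda>v. if v = (j, \<alpha>) then 1 else 0 :: complex"
  obtain l where l: "l < n" "l \<noteq> j" "Poly_Mapping.lookup \<alpha> l \<noteq> 0"
    using assms in_monomials_single_iff by blast
  show "poly ?p s \<noteq> 0"
  proof
    assume "poly ?p s = 0"
    then have "E (\<lambda>v. power_system D v + s * ?d v) = 0"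
      by (simp add: poly_int_mpoly_eval)
    then obtain x where x: "\<exists>l<n. x l \<noteq> 0"
      "\<forall>i<n. form_eval n D (\<lambda>v. power_system D v + s * ?d v) i x = 0"
      unfolding E_eq_0_iff by blast
    have eq: "x i ^ D + s * form_eval n D ?d i x = 0" if "i < n" for i
    proof -
      have "form_eval n D (\<lambda>v. power_system D v + s * ?d v) i x =
          form_eval n D (power_system D) i x + s * form_eval n D ?d i x"
        by (rule form_eval_lincomb) simp
      with x(2) that show ?thesis by (simp add: form_eval_power_system)
    qed
    have "x i = 0" if "i < n" "i \<noteq> j" for i
      using eq[of i] that assms(2) by (simp add: form_eval_unit)
    moreover from this have "form_eval n D ?d j x = 0"
      using l assms(2) by (auto simp: form_eval_unit intro!: prod_zero)
    then have "x j = 0"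
      using eq[OF assms(1)] by simp
    ultimately show False
      using x(1) by metis
  qed
qed

lemma grad_eq_coeff:
  assumes "v \<in> V"
  shows "int_mpoly_grad R (power_system D) v =
    coeff (E (\<lambda>w. [:power_system D w, if w = v then 1 else 0 :: complex:])) 1"
  by (subst coeff_1_int_mpoly_eval[OF finite_V keys_subset_V], subst sum.remove[OF finite_V assms])
     (auto intro!: sum.neutral)

lemma grad_off_diagonal:
  assumes "j < n" "\<alpha> \<in> monomials n D" "\<alpha> \<noteq> Poly_Mapping.single j D"
  shows "int_mpoly_grad R (power_system D) (j, \<alpha>) = (0 :: complex)"
  using assms by (simp add: grad_eq_coeff coeff_eq_0 E_perturb_const)

text \<open>Both sides are linear coefficients of \<open>E\<close> along lines that scale one
  equation by \<open>1 + s\<close>, and by \<open>E_scaled_power_eq\<close> the choice of the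
  equation does not matter.\<close>

lemma grad_diagonal_eq:
  assumes "i < n" "j < n"
  shows "int_mpoly_grad R (power_system D) (i, Poly_Mapping.single i D) =
    (int_mpoly_grad R (power_system D) (j, Poly_Mapping.single j D) :: complex)"
proof -
  define p where
    "p i = E (\<lambda>w. [:power_system D w, if w = (i, Poly_Mapping.single i D) then 1 else 0 :: complex:])" for i
  have p: "poly (p i) s = E (scaled_power i (1 + s))" for i s
    unfolding p_def poly_int_mpoly_eval
    by (rule E_cong) (simp add: scaled_power_def power_system_def)
  \<comment> \<open>The point \<open>-1\<close> means scaling by 0 and is left out; agreement on the
    infinite complement suffices.\<close>
  have "poly (p i - p j) s = 0" if "s \<in> - {-1}" for s
    using that assms by (simp add: p E_scaled_power_eq[of i j] add_eq_0_iff)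
  then have "- {-1} \<subseteq> {s. poly (p i - p j) s = 0}"
    by blast
  moreover have "infinite (- {-1 :: complex})"
    by (simp add: infinite_UNIV_char_0)
  ultimately have "p i = p j"
    by (metis eq_iff_diff_eq_0 finite_subset poly_roots_finite)
  then show ?thesis
    using assms by (simp add: grad_eq_coeff single_in_monomials p_def)
qed

section \<open>Homogeneity on a pencil and the top coefficients of the characteristic
  polynomial\<close>

text \<open>Scaling all equations by a nonzero c keeps the common zeros, so
  \<open>complex_poly_poly_monomial\<close> applies. The exponent may depend on \<open>a\<close>
  here; it turns out to be the degree of the characteristic polynomial.\<close>

lemma E_pencil_homogeneous:
  fixes a :: "coeff_var \<Rightarrow> complex"
  obtains N where "\<And>s c. E (\<lambda>v. c * (power_system D v + s * a v)) =
    c ^ N * E (\<lambda>v. power_system D v + s * a v)"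
proof -
  \<comment> \<open>The outer variable is the scaling factor c, the inner one the pencil parameter
    s.\<close>
  define p where "p = E (\<lambda>v. [:0, [:power_system D v, a v:]:])"
  have p: "poly (poly p [:c:]) s = E (\<lambda>v. c * (power_system D v + s * a v))" for c s
    unfolding p_def poly_int_mpoly_eval by (rule E_cong) (simp add: algebra_simps)
  have p1: "poly (poly p 1) s = E (\<lambda>v. power_system D v + s * a v)" for s
    using p[of 1 s] by (simp add: one_pCons)
  have "poly (poly p 1) 0 = 1"
    by (simp add: p1)
  then have "poly p 1 \<noteq> 0"
    by auto
  moreover have "poly (poly p [:c:]) s \<noteq> 0" if "c \<noteq> 0" "poly (poly p 1) s \<noteq> 0" for s c
  proof -
    have "form_eval n D (\<lambda>v. c * u v) i x = c * form_eval n D u i x" for u i x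
      using form_eval_lincomb[of "\<lambda>v. c * u v" i "\<lambda>_. 0" i c u i n D x]
      by (simp add: form_eval_def)
    then show ?thesis
      using that unfolding p p1 E_eq_0_iff by auto
  qed
  ultimately obtain N where N: "p = monom (poly p 1) N"
    using complex_poly_poly_monomial by blast
  have "poly (poly p [:c:]) s = c ^ N * poly (poly p 1) s" for c s
    by (subst N) (simp add: poly_monom poly_power mult.commute)
  then show thesis
    using that unfolding p p1 by blast
qed

text \<open>Factoring -z out of a - z e, with e the power system, shows that \<open>\<phi>\<close>
  is, up to sign, the reversal of \<psi>(s) = E(e - s a). So its top two coefficients come from
  \<psi>(0) = 1 and from the derivative at e, which sees only the diagonal coefficients of
  \<open>a\<close>.\<close>

lemma char_poly_coeffs:
  fixes a :: "coeff_var \<Rightarrow> complex"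
  defines "\<phi> \<equiv> E (\<lambda>v. [:a v, - power_system D v:])"
  shows "coeff \<phi> (degree \<phi>) = (-1) ^ degree \<phi>"
    and "degree \<phi> > 0 \<Longrightarrow> of_nat n * coeff \<phi> (degree \<phi> - 1) =
      - ((-1) ^ degree \<phi> * of_nat (degree \<phi>) * (\<Sum>i<n. a (i, Poly_Mapping.single i D)))"
proof -
  obtain N where N: "\<And>s c. E (\<lambda>v. c * (power_system D v + s * a v)) =
    c ^ N * E (\<lambda>v. power_system D v + s * a v)"
    using E_pencil_homogeneous[of a] by blast
  define \<psi> where "\<psi> = E (\<lambda>v. [:power_system D v, - a v:])"
  \<comment> \<open>The common value of all diagonal derivatives, read off at equation 0, which
    exists since \<open>n \<ge> 1\<close>.\<close>
  define g :: complex where "g = int_mpoly_grad R (power_system D) (0, Poly_Mapping.single 0 D)"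
  have lin: "coeff (E (\<lambda>v. [:power_system D v, b v:])) 1 = (\<Sum>i<n. b (i, Poly_Mapping.single i D)) * g"
    for b :: "coeff_var \<Rightarrow> complex"
  proof -
    have "coeff (E (\<lambda>v. [:power_system D v, b v:])) 1 =
        (\<Sum>i<n. \<Sum>\<alpha>\<in>monomials n D. b (i, \<alpha>) * int_mpoly_grad R (power_system D) (i, \<alpha>))"
      by (subst coeff_1_int_mpoly_eval[OF finite_V keys_subset_V])
         (simp add: sum.cartesian_product case_prod_unfold)
    also have "\<dots> = (\<Sum>i<n. b (i, Poly_Mapping.single i D) * g)"
    proof (rule sum.cong[OF refl])
      fix i assume i: "i \<in> {..<n}"
      then show "(\<Sum>\<alpha>\<in>monomials n D. b (i, \<alpha>) * int_mpoly_grad R (power_system D) (i, \<alpha>)) =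
          b (i, Poly_Mapping.single i D) * g"
        using n_pos grad_diagonal_eq[of i 0] unfolding g_def
        by (subst sum.remove[OF finite_monomials single_in_monomials[of i n D]])
           (auto simp: grad_off_diagonal intro!: sum.neutral)
    qed
    finally show ?thesis
      by (simp add: sum_distrib_right)
  qed
  have "poly \<phi> z = z ^ N * poly (smult ((-1) ^ N) \<psi>) (1 / z)" if "z \<noteq> 0" for z
  proof -
    have "poly \<phi> z = E (\<lambda>v. (- z) * (power_system D v + (- 1 / z) * a v))"
      unfolding \<phi>_def poly_int_mpoly_eval using that by (intro E_cong) (simp add: algebra_simps)
    also have "\<dots> = (- z) ^ N * poly \<psi> (1 / z)"
      unfolding N \<psi>_def poly_int_mpoly_eval by simp
    also have "(- z) ^ N = z ^ N * (-1) ^ N"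
      by (metis mult_minus1_right power_mult_distrib)
    finally show ?thesis by simp
  qed
  note coeffs = coeff_homogenize[OF this]
  have "coeff \<psi> 0 = poly \<psi> 0"
    by (simp add: poly_0_coeff_0)
  also have "\<dots> = 1"
    by (simp add: \<psi>_def poly_int_mpoly_eval)
  finally have lc: "coeff \<phi> N = (-1) ^ N"
    using coeffs(1)[of 0] by simp
  then have deg: "degree \<phi> = N"
    using coeffs(2) by (intro antisym degree_le le_degree) auto
  show "coeff \<phi> (degree \<phi>) = (-1) ^ degree \<phi>"
    using lc deg by simp
  \<comment> \<open>Euler's identity at the power system: compare the linear terms of E((1 + s) e) =
    (1 + s)^N.\<close>
  have ng: "of_nat n * g = of_nat N"
  proof -
    define \<chi> where "\<chi> = E (\<lambda>v. [:power_system D v, power_system D v :: complex:])"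
    have "poly \<chi> s = poly ([:1, 1:] ^ N) s" for s
    proof -
      have "poly \<chi> s = E (\<lambda>v. (1 + s) * (power_system D v + 0 * a v))"
        unfolding \<chi>_def poly_int_mpoly_eval by (intro E_cong) (simp add: algebra_simps)
      also have "\<dots> = (1 + s) ^ N"
        unfolding N by simp
      finally show ?thesis
        by (simp add: poly_power)
    qed
    then have "\<chi> = [:1, 1:] ^ N"
      by (simp add: poly_eq_poly_eq_iff[symmetric] fun_eq_iff)
    then have "poly (pderiv \<chi>) 0 = of_nat N"
      by (simp add: pderiv_power pderiv_pCons poly_power)
    moreover have "poly (pderiv \<chi>) 0 = of_nat n * g"
      using lin[of "power_system D"]
      by (simp add: \<chi>_def poly_0_coeff_0 coeff_pderiv power_system_def)
    ultimately show ?thesis by simp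
  qed
  have "coeff \<phi> (N - 1) = (-1) ^ N * coeff \<psi> 1" if "degree \<phi> > 0"
    using coeffs(1)[of 1] deg that by simp
  also have "coeff \<psi> 1 = - ((\<Sum>i<n. a (i, Poly_Mapping.single i D)) * g)"
    unfolding \<psi>_def lin by (simp add: sum_negf)
  finally show "of_nat n * coeff \<phi> (degree \<phi> - 1) =
      - ((-1) ^ degree \<phi> * of_nat (degree \<phi>) * (\<Sum>i<n. a (i, Poly_Mapping.single i D)))"
    if "degree \<phi> > 0"
    using that unfolding deg ng[symmetric] by simp
qed

end

subsection \<open>Tensors and their characteristic polynomials\<close>

text \<open>Exponent vector of the monomial that an index list contributes to a component.
  Rearranged lists give the same vector, so a coefficient collects several tensor entries.\<close>

definition exponents :: "nat list \<Rightarrow> (nat \<Rightarrow>\<^sub>0 nat)" where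
  "exponents js = (\<Sum>j\<leftarrow>js. Poly_Mapping.single j 1)"

lemma lookup_exponents: "Poly_Mapping.lookup (exponents js) i = count_list js i"
  by (induction js) (auto simp: exponents_def lookup_add lookup_single when_def)

lemma exponents_eq_single_iff:
  assumes "length js = k"
  shows "exponents js = Poly_Mapping.single i k \<longleftrightarrow> js = replicate k i"
proof
  assume *: "exponents js = Poly_Mapping.single i k"
  have "j = i" if "j \<in> set js" for j
  proof (rule ccontr)
    assume "j \<noteq> i"
    then have "count_list js j = 0"
      using * by (simp add: lookup_single when_def flip: lookup_exponents)
    with that show False
      by (simp add: count_list_0_iff)
  qed
  with assms show "js = replicate k i"
    by (metis replicate_length_same)
next
  assume "js = replicate k i"
  moreover have "exponents (replicate k i) = Poly_Mapping.single i k"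
    by (induction k) (simp_all add: exponents_def flip: single_add)
  ultimately show "exponents js = Poly_Mapping.single i k"
    by simp
qed

lemma lookup_tensor_component:
  "Poly_Mapping.lookup (tensor_component n m A i) \<alpha> =
     (\<Sum>js\<in>tensor_indices n (m - 1). if exponents js = \<alpha> then A (i # js) else 0)"
proof -
  have "(\<Prod>j\<leftarrow>js. Var j :: (nat, 'a) mpoly) = Poly_Mapping.single (exponents js) 1" for js
    by (induction js) (simp_all add: Var_def exponents_def mult_single)
  then show ?thesis
    by (simp add: tensor_component_def lookup_sum Const_def mult_single lookup_single when_def)
qed

lemma finite_tensor_indices: "finite (tensor_indices n k)"
  using finite_lists_length_eq[of "{..<n}" k] by (simp add: tensor_indices_def conj_commute)

text \<open>Only the constant list yields a pure power, so here a single entry is collected.\<close>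

lemma lookup_tensor_component_diagonal:
  assumes "i < n" "m \<ge> 1"
  shows "Poly_Mapping.lookup (tensor_component n m A i) (Poly_Mapping.single i (m - 1)) =
    A (replicate m i)"
proof -
  have "Poly_Mapping.lookup (tensor_component n m A i) (Poly_Mapping.single i (m - 1)) =
      (\<Sum>js\<in>tensor_indices n (m - 1). if js = replicate (m - 1) i then A (i # js) else 0)"
    unfolding lookup_tensor_component
    by (rule sum.cong) (auto simp: exponents_eq_single_iff tensor_indices_def)
  also have "\<dots> = A (i # replicate (m - 1) i)"
    using assms(1) by (subst sum.delta[OF finite_tensor_indices]) (auto simp: tensor_indices_def)
  also have "i # replicate (m - 1) i = replicate m i"
    using assms(2) by (cases m) auto
  finally show ?thesis .
qed

lemma lookup_identity_component:
  assumes "i < n" "m \<ge> 1"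
  shows "Poly_Mapping.lookup (tensor_component n m identity_tensor i) \<alpha> =
    (power_system (m - 1) (i, \<alpha>) :: 'a::comm_ring_1)"
proof -
  have "identity_tensor (i # js) = (if js = replicate (m - 1) i then 1 else 0 :: 'a)"
    if "js \<in> tensor_indices n (m - 1)" for js
    using that by (auto simp: identity_tensor_def tensor_indices_def intro!: replicate_eqI)
  then have "Poly_Mapping.lookup (tensor_component n m identity_tensor i) \<alpha> =
      (\<Sum>js\<in>tensor_indices n (m - 1). if js = replicate (m - 1) i then
        (if exponents js = \<alpha> then 1 else 0 :: 'a) else 0)"
    unfolding lookup_tensor_component by (intro sum.cong) auto
  also have "\<dots> = (if exponents (replicate (m - 1) i) = \<alpha> then 1 else 0)"
    using assms(1) by (subst sum.delta[OF finite_tensor_indices]) (auto simp: tensor_indices_def)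
  also have "exponents (replicate (m - 1) i) = Poly_Mapping.single i (m - 1)"
    by (simp add: exponents_eq_single_iff)
  finally show ?thesis
    by (auto simp: power_system_def)
qed

lemma sum_pCons: "(\<Sum>i\<in>I. [:f i, g i:]) = [:\<Sum>i\<in>I. f i, \<Sum>i\<in>I. g i:]"
  by (induction I rule: infinite_finite_induct) simp_all

text \<open>Brings the system of the characteristic polynomial into the linear form treated by
  \<open>char_poly_coeffs\<close>.\<close>

lemma lookup_char_component:
  assumes "i < n" "m \<ge> 1"
  shows "Poly_Mapping.lookup
      (tensor_component n m (\<lambda>js. [:A js:] - [:0, 1:] * identity_tensor js) i) \<alpha> =
    [:Poly_Mapping.lookup (tensor_component n m A i) \<alpha>, - power_system (m - 1) (i, \<alpha>):]"
proof -
  have "[:0, 1:] * identity_tensor js = [:0, identity_tensor js :: 'a:]" for js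
    by (simp add: identity_tensor_def)
  then show ?thesis
    unfolding lookup_identity_component[OF assms, symmetric] lookup_tensor_component
      sum_negf[symmetric] sum_pCons[symmetric]
    by (intro sum.cong) auto
qed

section \<open>Sum and product of the eigenvalues\<close>

text \<open>Vieta's formula for the sum of the roots. The induction carries the degree bound and the
  leading coefficient along.\<close>

lemma second_coeff_prod_linear:
  assumes "finite I"
    and "I \<noteq> {}"
  shows "coeff (\<Prod>i\<in>I. [:- r i, 1:]) (card I - 1) = - (\<Sum>i\<in>I. r i :: 'a::comm_ring_1)"
proof -
  have "degree (\<Prod>i\<in>I. [:- r i, 1:]) \<le> card I \<and> coeff (\<Prod>i\<in>I. [:- r i, 1:]) (card I) = 1 \<and>
    (I \<noteq> {} \<longrightarrow> coeff (\<Prod>i\<in>I. [:- r i, 1:]) (card I - 1) = - (\<Sum>i\<in>I. r i))"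
    using assms(1)
  proof induction
    case (insert j I)
    let ?Q = "\<Prod>i\<in>I. [:- r i, 1:]"
    have "degree ([:- r j, 1:] * ?Q) \<le> Suc (card I)"
      using insert.IH degree_mult_le[of "[:- r j, 1:]" ?Q] by simp
    moreover have "coeff ?Q (Suc (card I)) = 0"
      using insert.IH by (intro coeff_eq_0) simp
    ultimately show ?case
      using insert by (cases "card I") (auto simp: coeff_pCons)
  qed simp
  with assms(2) show ?thesis
    by blast
qed

text \<open>
  If there were no unique resultant, the characteristic polynomial would be the junk value \<open>0\<close>,
  which has no \<open>proots\<close>. So the hypothesis on the eigenvalues also yields the resultant.
\<close>

lemma eigenvalue_sum_and_prod:
  fixes A :: "real tensor" and ev :: "nat \<Rightarrow> real"
  assumes "m \<ge> 2" "n \<ge> 1" and d: "d = n * (m - 1) ^ (n - 1)" "d \<ge> 1"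
    and ev: "tensor_eigenvalues n m A = {# complex_of_real (ev j). j \<in># mset_set {1..d} #}"
  shows "(\<Sum>j=1..d. ev j) = real ((m - 1) ^ (n - 1)) * tensor_trace n m A"
    and "(\<Prod>j=1..d. ev j) = tensor_det n m A"
proof -
  define D where "D = m - 1"
  have m1: "m \<ge> 1"
    using \<open>m \<ge> 2\<close> by simp
  define R where "R = resultant_poly n (\<lambda>_. D)"
  define B where "B = (\<lambda>js. complex_of_real (A js))"
  define a where "a = (\<lambda>(i, \<alpha>). Poly_Mapping.lookup (tensor_component n m B i) \<alpha>)"
  define \<phi> where "\<phi> = tensor_char_poly n m B"
  have \<phi>_proots: "proots \<phi> = {# complex_of_real (ev j). j \<in># mset_set {1..d} #}"
    using ev by (simp add: \<phi>_def B_def tensor_eigenvalues_def)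
  have \<phi>: "\<phi> = int_mpoly_eval R (\<lambda>(i, \<alpha>). Poly_Mapping.lookup
      (tensor_component n m (\<lambda>js. [:B js:] - [:0, 1:] * identity_tensor js) i) \<alpha>)"
    by (simp add: \<phi>_def tensor_char_poly_def tensor_det_def multi_resultant_def
        eval_at_system_conv R_def D_def)
  have "\<phi> \<noteq> 0"
  proof
    assume "\<phi> = 0"
    with \<phi>_proots have "size (mset_set {1..d}) = 0"
      by (metis proots_0 size_empty size_image_mset)
    with d(2) show False by simp
  qed
  then have "R \<noteq> 0"
    by (auto simp: \<phi> int_mpoly_eval_def)
  then have "\<exists>!R. is_resultant n (\<lambda>_. D) R"
    unfolding R_def resultant_poly_def by metis
  then have "is_resultant n (\<lambda>_. D) R"
    unfolding R_def resultant_poly_def by (simp add: theI')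
  then interpret resultant_polynomial n D R
    using \<open>m \<ge> 2\<close> \<open>n \<ge> 1\<close> by unfold_locales (auto simp: D_def)
  have \<phi>_a: "\<phi> = E (\<lambda>v. [:a v, - power_system D v:])"
    unfolding \<phi> by (intro E_cong) (simp only: case_prod_conv lookup_char_component a_def D_def m1)
  \<comment> \<open>Over the complex numbers the degree is the number of roots, which the eigenvalue
    hypothesis prescribes.\<close>
  have degree: "degree \<phi> = d"
    using size_proots_complex[of \<phi>] by (simp add: \<phi>_proots)
  have lc: "coeff \<phi> d = (-1) ^ d"
    using char_poly_coeffs(1)[of a] by (simp flip: \<phi>_a add: degree)
  have prod: "\<phi> = smult ((-1) ^ d) (\<Prod>j=1..d. [:- complex_of_real (ev j), 1:])"
    using complex_poly_decompose_multiset[of \<phi>]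
    by (simp add: \<phi>_proots degree lc prod_unfold_prod_mset image_mset.compositionality o_def)
  have diag: "a (i, Poly_Mapping.single i D) = of_real (A (replicate m i))" if "i < n" for i
    using that m1 by (simp only: case_prod_conv a_def D_def B_def lookup_tensor_component_diagonal)
  have "coeff \<phi> (d - 1) = (-1) ^ d * - (\<Sum>j=1..d. complex_of_real (ev j))"
    using second_coeff_prod_linear[of "{1..d}" "\<lambda>j. complex_of_real (ev j)"] d(2)
    by (subst prod) simp
  moreover have "of_nat n * coeff \<phi> (d - 1) = - ((-1) ^ d * of_nat d * complex_of_real (tensor_trace n m A))"
    using char_poly_coeffs(2)[of a] d(2) by (simp flip: \<phi>_a add: degree diag tensor_trace_def)
  ultimately have "of_nat n * ((-1) ^ d * (\<Sum>j=1..d. complex_of_real (ev j))) =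
      (-1) ^ d * of_nat d * complex_of_real (tensor_trace n m A)"
    by (simp del: of_real_sum)
  then have "complex_of_real (real n * (\<Sum>j=1..d. ev j)) = complex_of_real (real d * tensor_trace n m A)"
    by (simp add: mult.left_commute[of _ "(-1) ^ d"] mult.assoc)
  then have "real n * (\<Sum>j=1..d. ev j) = real d * tensor_trace n m A"
    by (simp only: of_real_eq_iff)
  then show "(\<Sum>j=1..d. ev j) = real ((m - 1) ^ (n - 1)) * tensor_trace n m A"
    using assms(1,2) by (simp add: d(1))
  \<comment> \<open>The sign of the leading coefficient cancels those of the \<open>d\<close>
    factors at 0.\<close>
  have "poly \<phi> 0 = (-1) ^ d * (\<Prod>j=1..d. - complex_of_real (ev j))"
    by (subst prod) (simp add: poly_prod)
  also have "\<dots> = complex_of_real (\<Prod>j=1..d. ev j)"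
    by (simp add: prod_uminus flip: power_mult_distrib)
  also have "poly \<phi> 0 = E a"
    by (simp add: \<phi>_a poly_int_mpoly_eval)
  \<comment> \<open>Back to the reals: evaluation commutes with the embedding, so \<open>E a\<close>
    is the image of the real determinant.\<close>
  also have "E a = E (\<lambda>v. complex_of_real (case v of (i, \<alpha>) \<Rightarrow>
      Poly_Mapping.lookup (tensor_component n m A i) \<alpha>))"
    by (rule E_cong) (simp add: a_def B_def lookup_tensor_component if_distrib cong: if_cong)
  also have "\<dots> = complex_of_real (tensor_det n m A)"
    unfolding tensor_det_def multi_resultant_def eval_at_system_conv R_def D_def
    by (rule int_mpoly_eval_hom [symmetric]) auto
  finally show "(\<Prod>j=1..d. ev j) = tensor_det n m A"
    by (metis of_real_eq_iff)
qed

subsection \<open>The inequality\<close>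

text \<open>AM-GM without roots, obtained by raising the root form to the power
  \<open>card S\<close>.\<close>

lemma prod_le_mean_power:
  fixes x :: "'a \<Rightarrow> real"
  assumes "finite S" "S \<noteq> {}" "\<And>i. i \<in> S \<Longrightarrow> x i \<ge> 0"
  shows "(\<Prod>i\<in>S. x i) \<le> ((\<Sum>i\<in>S. x i) / card S) ^ card S"
proof -
  let ?P = "\<Prod>i\<in>S. x i"
  have "?P \<ge> 0"
    using assms by (simp add: prod_nonneg)
  have "card S > 0"
    using assms by (simp add: card_gt_0_iff)
  have "?P powr (1 / card S) \<le> (\<Sum>i\<in>S. x i) / card S"
    using arith_geom_mean[OF assms] by (simp add: sum_divide_distrib)
  then have "(?P powr (1 / card S)) ^ card S \<le> ((\<Sum>i\<in>S. x i) / card S) ^ card S"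
    by (intro power_mono) auto
  also have "(?P powr (1 / card S)) ^ card S = ?P"
    using \<open>?P \<ge> 0\<close> \<open>card S > 0\<close>
    by (cases "?P = 0") (simp_all add: powr_realpow[symmetric] powr_powr)
  finally show ?thesis .
qed

text \<open>
  AM-GM for the \<open>d + 1\<close> numbers obtained by scaling the first \<open>k\<close> of the \<open>x\<^sub>j\<close> by \<open>k / (k + 1)\<close> and
  adding \<open>(x\<^sub>1 + \<dots> + x\<^sub>k) / (k + 1)\<close>, which preserves the sum.
\<close>

lemma sum_mult_prod_le:
  fixes x :: "nat \<Rightarrow> real"
  assumes "1 \<le> k" "k \<le> d" and pos: "\<And>j. j \<in> {1..d} \<Longrightarrow> x j \<ge> 0"
  shows "(\<Sum>j=1..k. x j) * (\<Prod>j=1..d. x j) \<le>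
    real (k + 1) ^ (k + 1) / real k ^ k * ((\<Sum>j=1..d. x j) / real (d + 1)) ^ (d + 1)"
proof -
  define s where "s = (\<Sum>j=1..k. x j)"
  define q where "q = real k / real (k + 1)"
  define y where "y j = (if j = 0 then s / real (k + 1) else if j \<le> k then q * x j else x j)" for j
  have "s \<ge> 0"
    unfolding s_def using assms by (intro sum_nonneg) auto
  have split: "{0..d} = insert 0 ({1..k} \<union> {k<..d})" "{1..d} = {1..k} \<union> {k<..d}"
    using assms by auto
  have "(\<Sum>j=0..d. y j) = s / real (k + 1) + (\<Sum>j=1..k. y j) + (\<Sum>j\<in>{k<..d}. y j)"
    unfolding split by (subst sum.insert, simp, simp, subst sum.union_disjoint) (auto simp: y_def)
  also have "(\<Sum>j=1..k. y j) = q * s"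
    unfolding s_def sum_distrib_left by (rule sum.cong) (auto simp: y_def)
  also have "(\<Sum>j\<in>{k<..d}. y j) = (\<Sum>j\<in>{k<..d}. x j)"
    by (rule sum.cong) (auto simp: y_def)
  also have "s / real (k + 1) + q * s = s"
  proof -
    have "q = 1 - 1 / real (k + 1)"
      by (simp add: q_def field_simps)
    then show ?thesis
      by (simp add: left_diff_distrib)
  qed
  also have "s + (\<Sum>j\<in>{k<..d}. x j) = (\<Sum>j=1..d. x j)"
    unfolding s_def split by (rule sum.union_disjoint [symmetric]) auto
  finally have sum: "(\<Sum>j=0..d. y j) = (\<Sum>j=1..d. x j)" .
  have "(\<Prod>j=0..d. y j) = s / real (k + 1) * ((\<Prod>j=1..k. y j) * (\<Prod>j\<in>{k<..d}. y j))"
    unfolding split by (subst prod.insert, simp, simp, subst prod.union_disjoint) (auto simp: y_def)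
  also have "(\<Prod>j=1..k. y j) = (\<Prod>j=1..k. q * x j)"
    by (rule prod.cong) (auto simp: y_def)
  also have "\<dots> = q ^ k * (\<Prod>j=1..k. x j)"
    by (simp add: prod.distrib)
  also have "(\<Prod>j\<in>{k<..d}. y j) = (\<Prod>j\<in>{k<..d}. x j)"
    by (rule prod.cong) (auto simp: y_def)
  also have "q ^ k * (\<Prod>j=1..k. x j) * (\<Prod>j\<in>{k<..d}. x j) = q ^ k * (\<Prod>j=1..d. x j)"
    unfolding split by (subst prod.union_disjoint) auto
  finally have prod: "(\<Prod>j=0..d. y j) = s / real (k + 1) * (q ^ k * (\<Prod>j=1..d. x j))" .
  have "y j \<ge> 0" if "j \<in> {0..d}" for j
    using that pos[of j] \<open>s \<ge> 0\<close> by (auto simp: y_def q_def)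
  then have "(\<Prod>j=0..d. y j) \<le> ((\<Sum>j=0..d. y j) / real (d + 1)) ^ (d + 1)"
    using prod_le_mean_power[of "{0..d}" y] by (simp add: add.commute)
  then have "s / real (k + 1) * (q ^ k * (\<Prod>j=1..d. x j)) \<le>
      ((\<Sum>j=1..d. x j) / real (d + 1)) ^ (d + 1)"
    unfolding sum prod .
  \<comment> \<open>The constant is the reciprocal of \<open>q ^ k / real (k + 1)\<close>, the
    factor gained by the product of the \<open>y j\<close>.\<close>
  then have "real (k + 1) ^ (k + 1) / real k ^ k * (s / real (k + 1) * (q ^ k * (\<Prod>j=1..d. x j))) \<le>
      real (k + 1) ^ (k + 1) / real k ^ k * ((\<Sum>j=1..d. x j) / real (d + 1)) ^ (d + 1)"
    by (rule mult_left_mono) simp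
  also have "real (k + 1) ^ (k + 1) / real k ^ k * (s / real (k + 1) * (q ^ k * (\<Prod>j=1..d. x j))) =
      s * (\<Prod>j=1..d. x j)"
  proof -
    have "b * a / c * (s / a * (c / b * P)) = s * P" if "a \<noteq> 0" "b \<noteq> 0" "c \<noteq> 0" for a b c P :: real
      using that by simp
    from this[of "real (k + 1)" "real (k + 1) ^ k" "real k ^ k"] show ?thesis
      using assms(1) by (simp only: q_def power_divide power_add power_one_right) simp
  qed
  finally show ?thesis
    unfolding s_def .
qed

theorem theorem3p6:
  fixes n m d k :: nat
    and A :: "real tensor"
    and ev :: "nat \<Rightarrow> real"
  assumes "m \<ge> 2" and "even m" and "n \<ge> 1"
    and "symmetric_tensor n m A"
    and "d = n * (m - 1) ^ (n - 1)"
    and "tensor_eigenvalues n m A = {# complex_of_real (ev j). j \<in># mset_set {1..d} #}"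
    and "\<forall>i j. 1 \<le> i \<and> i \<le> j \<and> j \<le> d \<longrightarrow> ev i \<ge> ev j"
    and "\<forall>j\<in>{1..d}. ev j > 0"
    and "1 \<le> k" and "k \<le> d"
  shows "(\<Sum>j=1..k. ev j) \<le>
    real (k + 1) ^ (k + 1) / real k ^ k * (1 / tensor_det n m A) *
    (real ((m - 1) ^ (n - 1)) * tensor_trace n m A / real (d + 1)) ^ (d + 1)"
proof -
  have "d \<ge> 1"
    using \<open>1 \<le> k\<close> \<open>k \<le> d\<close> by simp
  note eigen = eigenvalue_sum_and_prod[OF assms(1,3,5) this assms(6)]
  \<comment> \<open>As a product of positive eigenvalues the determinant may be divided by.\<close>
  have "tensor_det n m A > 0"
    using assms(8) unfolding eigen(2)[symmetric] by (intro prod_pos) auto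
  moreover have "(\<Sum>j=1..k. ev j) * tensor_det n m A \<le> real (k + 1) ^ (k + 1) / real k ^ k *
      (real ((m - 1) ^ (n - 1)) * tensor_trace n m A / real (d + 1)) ^ (d + 1)"
    using sum_mult_prod_le[of k d ev] assms(8-10) unfolding eigen by (auto simp: less_imp_le)
  ultimately have "(\<Sum>j=1..k. ev j) \<le> real (k + 1) ^ (k + 1) / real k ^ k *
      (real ((m - 1) ^ (n - 1)) * tensor_trace n m A / real (d + 1)) ^ (d + 1) / tensor_det n m A"
    by (simp only: pos_le_divide_eq)
  then show ?thesis
    by (simp add: mult_ac)
qed

end
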